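(* Let $G$ be a Lie group with Lie algebra $\mathfrak{g}$, equipped with a left invariant statistical structure $(g,\nabla)$, $g=\langle\cdot,\cdot\rangle$. Then the linear connection $\nabla$ is determined by a symmetric bilinear map $\nu:\mathfrak{g}\times\mathfrak{g}\to\mathfrak{g}$ satisfying \[ \langle U(Y,Z),X\rangle-\langle U(X,Z),Y\rangle=\langle \nu(Y,Z),X\rangle-\langle \nu(X,Z),Y\rangle \] for all $X,Y,Z\in\mathfrak{g}$, and $\nabla$ is represented as \[ \nabla_XY=\nu(X,Y)+\frac12[X,Y],\qquad X,Y\in\mathfrak{g}. \]
   Context: Elements of $\mathfrak{g}$ are identified with left invariant vector fields on $G$. A left invariant statistical structure $(g,\nabla)$ on $G$ consists of a left invariant Riemannian metric $g=\langle\cdot,\cdot\rangle$ and a left invariant torsion free linear connection $\nabla$ such that $\nabla g$ is totally symmetric. A left invariant connection is determined by its values $\nabla_XY\in\mathfrak{g}$ for $X,Y\in\mathfrak{g}$. The symmetric bilinear map $U:\mathfrak{g}\times\mathfrak{g}\to\mathfrak{g}$ is defined by \[ 2\langle U(X,Y),Z\rangle=\langle X,[Z,Y]\rangle+\langle Y,[Z,X]\rangle,\qquad X,Y,Z\in\mathfrak{g}. \] *)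

theory Defs
  imports "HOL-Analysis.Analysis"
begin

section \<open>Smooth maps between Euclidean spaces\<close>

text \<open>Both predicates are only meant for open \<open>S\<close>, where \<^term>\<open>frechet_derivative f (at x)\<close>
  depends only on \<open>f\<close> restricted to \<open>S\<close>. In finite dimension, a map is \<open>k + 1\<close> times
  continuously differentiable iff it is differentiable and all its directional derivatives
  are \<open>k\<close> times continuously differentiable.\<close>

primrec Ck_on :: "nat \<Rightarrow> ('a::real_normed_vector \<Rightarrow> 'b::real_normed_vector) \<Rightarrow> 'a set \<Rightarrow> bool" where
  "Ck_on 0 f S \<longleftrightarrow> continuous_on S f"
| "Ck_on (Suc k) f S \<longleftrightarrow>
     f differentiable_on S \<and> (\<forall>v. Ck_on k (\<lambda>x. frechet_derivative f (at x) v) S)"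

definition smooth_on :: "'a::real_normed_vector set \<Rightarrow> ('a \<Rightarrow> 'b::real_normed_vector) \<Rightarrow> bool" where
  "smooth_on S f \<longleftrightarrow> (\<forall>k. Ck_on k f S)"


section \<open>Smooth manifolds and Lie groups\<close>

text \<open>A chart is given by its domain \<open>U\<close> and a map \<open>\<phi>\<close>, of which only the values on \<open>U\<close> matter.\<close>

type_synonym ('g, 'e) chart = "'g set \<times> ('g \<Rightarrow> 'e)"

definition chart_inv :: "('g, 'e) chart \<Rightarrow> 'e \<Rightarrow> 'g" where
  "chart_inv c = inv_into (fst c) (snd c)"

definition is_chart :: "('g::topological_space, 'e::euclidean_space) chart \<Rightarrow> bool" where
  "is_chart c \<longleftrightarrow> open (fst c) \<and> open (snd c ` fst c) \<and>
     homeomorphism (fst c) (snd c ` fst c) (snd c) (chart_inv c)"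

definition smooth_atlas :: "('g::topological_space, 'e::euclidean_space) chart set \<Rightarrow> bool" where
  "smooth_atlas A \<longleftrightarrow>
     (\<forall>c\<in>A. is_chart c) \<and> (\<Union>c\<in>A. fst c) = UNIV \<and>
     (\<forall>c\<in>A. \<forall>d\<in>A. smooth_on (snd c ` (fst c \<inter> fst d)) (snd d \<circ> chart_inv c))"

text \<open>The group is the whole type \<open>'g\<close>. The class \<^class>\<open>topological_group_add\<close> does not assume
  commutativity, so \<open>a + b\<close>, \<open>- a\<close> and \<open>0\<close> are the product, the inverse and the identity of an
  arbitrary topological group. The smooth structure is the one generated by the atlas \<open>A\<close>.\<close>

definition lie_group ::
  "('g::{topological_group_add, t2_space, second_countable_topology}, 'e::euclidean_space) chart set \<Rightarrow> bool"
where
  "lie_group A \<longleftrightarrow> smooth_atlas A \<and>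
     (\<forall>c\<in>A. \<forall>d\<in>A. \<forall>e\<in>A.
        smooth_on {(x, y). x \<in> snd c ` fst c \<and> y \<in> snd d ` fst d \<and> chart_inv c x + chart_inv d y \<in> fst e}
          (\<lambda>(x, y). snd e (chart_inv c x + chart_inv d y))) \<and>
     (\<forall>c\<in>A. \<forall>d\<in>A.
        smooth_on {x. x \<in> snd c ` fst c \<and> - chart_inv c x \<in> fst d} (\<lambda>x. snd d (- chart_inv c x)))"

definition smooth_fun :: "('g, 'e::euclidean_space) chart set \<Rightarrow> ('g \<Rightarrow> real) \<Rightarrow> bool" where
  "smooth_fun A f \<longleftrightarrow> (\<forall>c\<in>A. smooth_on (snd c ` fst c) (f \<circ> chart_inv c))"


section \<open>Tangent vectors and vector fields\<close>

text \<open>Tangent vectors act on smooth functions as directional derivatives. The value on functions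
  that are not smooth is fixed to be \<open>0\<close>, so that two tangent vectors are equal as soon as they
  agree on smooth functions.\<close>

type_synonym 'g tvector = "('g \<Rightarrow> real) \<Rightarrow> real"
type_synonym 'g vfield = "'g \<Rightarrow> 'g tvector"

text \<open>The tangent vector \<open>\<Sum>i. w\<^sub>i (\<partial>/\<partial>x\<^sub>i)\<close> at \<open>p\<close>, where the \<open>x\<^sub>i\<close> are the coordinates of
  the chart \<open>c\<close>.\<close>

definition coord_tvector ::
  "('g, 'e::euclidean_space) chart set \<Rightarrow> ('g, 'e) chart \<Rightarrow> 'g \<Rightarrow> 'e \<Rightarrow> 'g tvector" where
  "coord_tvector A c p w =
     (\<lambda>f. if smooth_fun A f then frechet_derivative (f \<circ> chart_inv c) (at (snd c p)) w else 0)"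

definition tangent_space :: "('g, 'e::euclidean_space) chart set \<Rightarrow> 'g \<Rightarrow> 'g tvector set" where
  "tangent_space A p = {v. \<exists>c\<in>A. p \<in> fst c \<and> (\<exists>w. v = coord_tvector A c p w)}"

definition vector_field :: "('g, 'e::euclidean_space) chart set \<Rightarrow> 'g vfield \<Rightarrow> bool" where
  "vector_field A X \<longleftrightarrow>
     (\<forall>c\<in>A. \<exists>\<xi>. smooth_on (snd c ` fst c) \<xi> \<and> (\<forall>p\<in>fst c. X p = coord_tvector A c p (\<xi> (snd c p))))"

definition lie_bracket :: "'g vfield \<Rightarrow> 'g vfield \<Rightarrow> 'g vfield" where
  "lie_bracket X Y = (\<lambda>p f. X p (\<lambda>q. Y q f) - Y p (\<lambda>q. X q f))"

definition vf_lincomb :: "real \<Rightarrow> 'g vfield \<Rightarrow> real \<Rightarrow> 'g vfield \<Rightarrow> 'g vfield" where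
  "vf_lincomb a X b Y = (\<lambda>p f. a * X p f + b * Y p f)"

definition vf_mult :: "('g \<Rightarrow> real) \<Rightarrow> 'g vfield \<Rightarrow> 'g vfield" where
  "vf_mult h X = (\<lambda>p f. h p * X p f)"


section \<open>Left translations and the Lie algebra\<close>

text \<open>The differential of the left translation by \<open>a\<close>.\<close>

definition d_left :: "'g::group_add \<Rightarrow> 'g tvector \<Rightarrow> 'g tvector" where
  "d_left a v = (\<lambda>f. v (\<lambda>q. f (a + q)))"

definition push_left :: "'g::group_add \<Rightarrow> 'g vfield \<Rightarrow> 'g vfield" where
  "push_left a X = (\<lambda>p. d_left a (X (- a + p)))"

definition lie_algebra :: "('g::group_add, 'e::euclidean_space) chart set \<Rightarrow> 'g vfield set" where
  "lie_algebra A = {X. vector_field A X \<and> (\<forall>a. push_left a X = X)}"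


section \<open>Left invariant statistical structures\<close>

definition riemannian_metric ::
  "('g, 'e::euclidean_space) chart set \<Rightarrow> ('g \<Rightarrow> 'g tvector \<Rightarrow> 'g tvector \<Rightarrow> real) \<Rightarrow> bool" where
  "riemannian_metric A g \<longleftrightarrow>
     (\<forall>p. \<forall>u\<in>tangent_space A p. \<forall>v\<in>tangent_space A p. g p u v = g p v u) \<and>
     (\<forall>p. \<forall>u\<in>tangent_space A p. \<forall>v\<in>tangent_space A p. \<forall>w\<in>tangent_space A p. \<forall>a b.
        g p (\<lambda>f. a * u f + b * v f) w = a * g p u w + b * g p v w) \<and>
     (\<forall>p. \<forall>u\<in>tangent_space A p. u \<noteq> (\<lambda>f. 0) \<longrightarrow> g p u u > 0) \<and>
     (\<forall>X Y. vector_field A X \<longrightarrow> vector_field A Y \<longrightarrow> smooth_fun A (\<lambda>p. g p (X p) (Y p)))"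

definition left_invariant_metric ::
  "('g::group_add, 'e::euclidean_space) chart set \<Rightarrow> ('g \<Rightarrow> 'g tvector \<Rightarrow> 'g tvector \<Rightarrow> real) \<Rightarrow> bool" where
  "left_invariant_metric A g \<longleftrightarrow> riemannian_metric A g \<and>
     (\<forall>a p. \<forall>u\<in>tangent_space A p. \<forall>v\<in>tangent_space A p. g (a + p) (d_left a u) (d_left a v) = g p u v)"

text \<open>\<open>D X Y\<close> is the covariant derivative of \<open>Y\<close> along \<open>X\<close>; it is only constrained on
  vector fields.\<close>

definition linear_connection ::
  "('g, 'e::euclidean_space) chart set \<Rightarrow> ('g vfield \<Rightarrow> 'g vfield \<Rightarrow> 'g vfield) \<Rightarrow> bool" where
  "linear_connection A D \<longleftrightarrow>
     (\<forall>X Y. vector_field A X \<longrightarrow> vector_field A Y \<longrightarrow> vector_field A (D X Y)) \<and>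
     (\<forall>X X' Y. vector_field A X \<longrightarrow> vector_field A X' \<longrightarrow> vector_field A Y \<longrightarrow>
        D (vf_lincomb 1 X 1 X') Y = vf_lincomb 1 (D X Y) 1 (D X' Y)) \<and>
     (\<forall>h X Y. smooth_fun A h \<longrightarrow> vector_field A X \<longrightarrow> vector_field A Y \<longrightarrow>
        D (vf_mult h X) Y = vf_mult h (D X Y)) \<and>
     (\<forall>X Y Y'. vector_field A X \<longrightarrow> vector_field A Y \<longrightarrow> vector_field A Y' \<longrightarrow>
        D X (vf_lincomb 1 Y 1 Y') = vf_lincomb 1 (D X Y) 1 (D X Y')) \<and>
     (\<forall>h X Y. smooth_fun A h \<longrightarrow> vector_field A X \<longrightarrow> vector_field A Y \<longrightarrow>
        D X (vf_mult h Y) = vf_lincomb 1 (vf_mult (\<lambda>p. X p h) Y) 1 (vf_mult h (D X Y)))"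

definition left_invariant_connection ::
  "('g::group_add, 'e::euclidean_space) chart set \<Rightarrow> ('g vfield \<Rightarrow> 'g vfield \<Rightarrow> 'g vfield) \<Rightarrow> bool" where
  "left_invariant_connection A D \<longleftrightarrow> linear_connection A D \<and>
     (\<forall>a X Y. vector_field A X \<longrightarrow> vector_field A Y \<longrightarrow>
        D (push_left a X) (push_left a Y) = push_left a (D X Y))"

definition torsion_free ::
  "('g, 'e::euclidean_space) chart set \<Rightarrow> ('g vfield \<Rightarrow> 'g vfield \<Rightarrow> 'g vfield) \<Rightarrow> bool" where
  "torsion_free A D \<longleftrightarrow>
     (\<forall>X Y. vector_field A X \<longrightarrow> vector_field A Y \<longrightarrow>
        vf_lincomb 1 (D X Y) (- 1) (D Y X) = lie_bracket X Y)"

text \<open>The covariant derivative of the metric, as the tensor field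
  \<open>(X, Y, Z) \<mapsto> X (g (Y, Z)) - g (D X Y, Z) - g (Y, D X Z)\<close>.\<close>

definition nabla_metric ::
  "('g \<Rightarrow> 'g tvector \<Rightarrow> 'g tvector \<Rightarrow> real) \<Rightarrow> ('g vfield \<Rightarrow> 'g vfield \<Rightarrow> 'g vfield) \<Rightarrow>
   'g vfield \<Rightarrow> 'g vfield \<Rightarrow> 'g vfield \<Rightarrow> 'g \<Rightarrow> real" where
  "nabla_metric g D X Y Z =
     (\<lambda>p. X p (\<lambda>q. g q (Y q) (Z q)) - g p (D X Y p) (Z p) - g p (Y p) (D X Z p))"

text \<open>Invariance under two adjacent transpositions is invariance under all permutations of the
  three arguments.\<close>

definition totally_symmetric ::
  "('g, 'e::euclidean_space) chart set \<Rightarrow> ('g vfield \<Rightarrow> 'g vfield \<Rightarrow> 'g vfield \<Rightarrow> 'g \<Rightarrow> real) \<Rightarrow> bool" where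
  "totally_symmetric A C \<longleftrightarrow>
     (\<forall>X Y Z. vector_field A X \<longrightarrow> vector_field A Y \<longrightarrow> vector_field A Z \<longrightarrow>
        C X Y Z = C Y X Z \<and> C X Y Z = C X Z Y)"

definition left_invariant_statistical_structure ::
  "('g::group_add, 'e::euclidean_space) chart set \<Rightarrow> ('g \<Rightarrow> 'g tvector \<Rightarrow> 'g tvector \<Rightarrow> real) \<Rightarrow>
   ('g vfield \<Rightarrow> 'g vfield \<Rightarrow> 'g vfield) \<Rightarrow> bool" where
  "left_invariant_statistical_structure A g D \<longleftrightarrow>
     left_invariant_metric A g \<and> left_invariant_connection A D \<and> torsion_free A D \<and>
     totally_symmetric A (nabla_metric g D)"


section \<open>Algebraic data on the Lie algebra\<close>

text \<open>The inner product of two left invariant vector fields is a constant function on the group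
  if \<open>g\<close> is left invariant; it is read off at the identity.\<close>

definition lie_inner :: "('g::zero \<Rightarrow> 'g tvector \<Rightarrow> 'g tvector \<Rightarrow> real) \<Rightarrow> 'g vfield \<Rightarrow> 'g vfield \<Rightarrow> real" where
  "lie_inner g X Y = g 0 (X 0) (Y 0)"

definition U_map ::
  "('g::group_add, 'e::euclidean_space) chart set \<Rightarrow> ('g \<Rightarrow> 'g tvector \<Rightarrow> 'g tvector \<Rightarrow> real) \<Rightarrow>
   'g vfield \<Rightarrow> 'g vfield \<Rightarrow> 'g vfield" where
  "U_map A g X Y = (THE W. W \<in> lie_algebra A \<and>
     (\<forall>Z\<in>lie_algebra A.
        2 * lie_inner g W Z = lie_inner g X (lie_bracket Z Y) + lie_inner g Y (lie_bracket Z X)))"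

definition symmetric_bilinear_on_lie_algebra ::
  "('g::group_add, 'e::euclidean_space) chart set \<Rightarrow> ('g vfield \<Rightarrow> 'g vfield \<Rightarrow> 'g vfield) \<Rightarrow> bool" where
  "symmetric_bilinear_on_lie_algebra A \<nu> \<longleftrightarrow>
     (\<forall>X\<in>lie_algebra A. \<forall>Y\<in>lie_algebra A. \<nu> X Y \<in> lie_algebra A \<and> \<nu> X Y = \<nu> Y X) \<and>
     (\<forall>X\<in>lie_algebra A. \<forall>Y\<in>lie_algebra A. \<forall>Z\<in>lie_algebra A. \<forall>a b.
        \<nu> (vf_lincomb a X b Y) Z = vf_lincomb a (\<nu> X Z) b (\<nu> Y Z) \<and>
        \<nu> Z (vf_lincomb a X b Y) = vf_lincomb a (\<nu> Z X) b (\<nu> Z Y))"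

text \<open>The values of \<open>D\<close> on the Lie algebra are those given by \<open>\<nu>\<close>.\<close>

definition represented_by ::
  "('g::group_add, 'e::euclidean_space) chart set \<Rightarrow> ('g vfield \<Rightarrow> 'g vfield \<Rightarrow> 'g vfield) \<Rightarrow>
   ('g vfield \<Rightarrow> 'g vfield \<Rightarrow> 'g vfield) \<Rightarrow> bool" where
  "represented_by A D \<nu> \<longleftrightarrow>
     (\<forall>X\<in>lie_algebra A. \<forall>Y\<in>lie_algebra A.
        D X Y = vf_lincomb 1 (\<nu> X Y) (1 / 2) (lie_bracket X Y))"

end

theory Submission
  imports Defs
begin

text \<open>The map \<open>\<nu>\<close> has to be the symmetric part of \<open>\<nabla>\<close> on the Lie algebra,
  \<open>\<nu>(X, Y) = (\<nabla>\<^sub>X Y + \<nabla>\<^sub>Y X) / 2\<close>, since absence of torsion says that the skew part is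
  \<open>[X, Y] / 2\<close>. Inner products of left invariant fields are constant, so the total symmetry of
  \<open>\<nabla>g\<close> becomes the identity
  \<open>\<langle>\<nabla>\<^sub>X Y, Z\<rangle> + \<langle>\<nabla>\<^sub>X Z, Y\<rangle> = \<langle>\<nabla>\<^sub>Y X, Z\<rangle> + \<langle>\<nabla>\<^sub>Y Z, X\<rangle>\<close> (\<open>codazzi\<close>).
  Writing the brackets in the defining property of \<open>U\<close> as differences of covariant derivatives
  turns the condition on \<open>\<nu>\<close> into this identity, up to terms that cancel
  (\<open>sym_part_U_map\<close>).

  The analysis enters in two places. First, \<open>U\<close> is defined by its inner products, so its
  existence requires that every linear functional on the Lie algebra be an inner product with some
  element. This follows from a finite orthonormal basis, which exists because a left invariant
  field is determined by its value at the identity and this value by a vector of the model space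
  (\<open>orthonormal_card\<close>, \<open>ex_orthonormal_basis\<close>, \<open>inner_representation\<close>).

  Second, \<open>\<nu>\<close> determines \<open>\<nabla>\<close> on all vector fields because the group is parallelizable: every
  tangent vector at the identity extends to a left invariant field (\<open>left_invariant_extension\<close>),
  so an orthonormal basis of the Lie algebra is a global frame. The coefficients of a vector field
  \<open>X\<close> in it are the functions \<open>g(X, E)\<close>, which are smooth (\<open>ex_global_frame\<close>), and then linearity
  and the Leibniz rule reduce \<open>\<nabla>\<close> to its values on the frame.

  Smoothness of the extension is that of a partial derivative of the multiplication in charts; it
  rests on the stability of iterated directional derivatives under sums, products and composition
  (\<open>Ck_on_compose\<close>).\<close>

section \<open>Calculus of continuously differentiable maps\<close>

lemma frechet_derivative_cong_open:
  assumes "open S" "x \<in> S" "\<And>y. y \<in> S \<Longrightarrow> f y = g y"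
  shows "frechet_derivative f (at x) = frechet_derivative g (at x)"
proof -
  have "(f has_derivative f') (at x) \<longleftrightarrow> (g has_derivative f') (at x)" for f'
    using assms by (metis has_derivative_transform_within_open)
  then show ?thesis
    by (simp add: frechet_derivative_def)
qed

lemma Ck_on_cong:
  assumes "open S" "\<And>y. y \<in> S \<Longrightarrow> f y = g y" "Ck_on k f S"
  shows "Ck_on k g S"
  using assms(2,3)
proof (induction k arbitrary: f g)
  case 0
  then show ?case by (simp cong: continuous_on_cong)
next
  case (Suc k)
  have "g differentiable_on S"
    using Suc.prems differentiable_transform_within[where d = 1, OF _ zero_less_one]
    unfolding differentiable_on_def by (metis Ck_on.simps(2) differentiable_on_def)
  moreover have "Ck_on k (\<lambda>x. frechet_derivative g (at x) v) S" for v
  proof (rule Suc.IH)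
    show "Ck_on k (\<lambda>x. frechet_derivative f (at x) v) S"
      using Suc.prems by simp
    show "frechet_derivative f (at y) v = frechet_derivative g (at y) v" if "y \<in> S" for y
      using frechet_derivative_cong_open[OF assms(1) that] Suc.prems(1) by metis
  qed
  ultimately show ?case by simp
qed

text \<open>Any family of derivatives may be used in place of the chosen one, so that the rules of
  differentiation apply directly in the inductions on the order.\<close>

lemma Ck_on_SucI:
  assumes "open S" "\<And>x. x \<in> S \<Longrightarrow> (f has_derivative f' x) (at x)" "\<And>v. Ck_on k (\<lambda>x. f' x v) S"
  shows "Ck_on (Suc k) f S"
proof -
  have "f differentiable_on S"
    using assms(2) differentiable_at_imp_differentiable_on differentiable_def by blast
  moreover have "Ck_on k (\<lambda>x. frechet_derivative f (at x) v) S" for v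
    using assms(1) _ assms(3)
  proof (rule Ck_on_cong)
    show "f' y v = frechet_derivative f (at y) v" if "y \<in> S" for y
      using frechet_derivative_at[OF assms(2)[OF that]] by simp
  qed
  ultimately show ?thesis by simp
qed

lemma Ck_on_Suc_has_derivative:
  assumes "Ck_on (Suc k) f S" "open S" "x \<in> S"
  shows "(f has_derivative frechet_derivative f (at x)) (at x)"
proof -
  have "f differentiable (at x)"
    using assms by (simp add: differentiable_on_eq_differentiable_at)
  then show ?thesis
    by (simp add: frechet_derivative_works)
qed

lemma Ck_on_SucD: "Ck_on (Suc k) f S \<Longrightarrow> Ck_on k f S"
proof (induction k arbitrary: f)
  case 0
  then show ?case by (simp add: differentiable_imp_continuous_on)
next
  case (Suc k)
  then show ?case by (metis Ck_on.simps(2))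
qed

lemma Ck_on_local:
  assumes "open S" "\<And>x. x \<in> S \<Longrightarrow> \<exists>T. open T \<and> x \<in> T \<and> T \<subseteq> S \<and> Ck_on k f T"
  shows "Ck_on k f S"
  using assms(2)
proof (induction k arbitrary: f)
  case 0
  then have "continuous (at x) f" if "x \<in> S" for x
    using that by (metis Ck_on.simps(1) continuous_on_eq_continuous_at)
  then show ?case
    by (simp add: continuous_at_imp_continuous_on)
next
  case (Suc k)
  have "f differentiable (at x)" if "x \<in> S" for x
    using Suc.prems[OF that] by (metis Ck_on.simps(2) differentiable_on_eq_differentiable_at)
  then have "f differentiable_on S"
    by (simp add: differentiable_at_imp_differentiable_on)
  moreover have "Ck_on k (\<lambda>x. frechet_derivative f (at x) v) S" for v
    using Suc.prems by (intro Suc.IH) (metis Ck_on.simps(2))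
  ultimately show ?case by simp
qed

lemma Ck_on_const: "Ck_on k (\<lambda>x. c) S"
proof (induction k arbitrary: c)
  case (Suc k)
  have "frechet_derivative (\<lambda>x. c) (at x) = (\<lambda>v. 0)" for x :: 'a
    using frechet_derivative_at[OF has_derivative_const] by metis
  then show ?case using Suc by simp
qed auto

lemma Ck_on_affine:
  assumes "bounded_linear h" "open S"
  shows "Ck_on k (\<lambda>x. h x + c) S"
proof (cases k)
  case 0
  then show ?thesis
    by (simp add: continuous_on_add linear_continuous_on[OF assms(1)])
next
  case (Suc j)
  have "((\<lambda>x. h x + c) has_derivative h) (at x)" for x
    using has_derivative_add[OF bounded_linear_imp_has_derivative[OF assms(1)] has_derivative_const]
    by simp
  then show ?thesis unfolding Suc
    by (rule Ck_on_SucI[OF assms(2)]) (rule Ck_on_const)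
qed

lemma Ck_on_add:
  assumes "open S" "Ck_on k f S" "Ck_on k g S"
  shows "Ck_on k (\<lambda>x. f x + g x) S"
  using assms(2,3)
proof (induction k arbitrary: f g)
  case 0
  then show ?case by (auto intro!: continuous_intros)
next
  case (Suc k)
  show ?case
  proof (rule Ck_on_SucI[OF assms(1)])
    show "((\<lambda>x. f x + g x) has_derivative
        (\<lambda>v. frechet_derivative f (at x) v + frechet_derivative g (at x) v)) (at x)"
      if "x \<in> S" for x
      using Suc.prems that assms(1) by (intro has_derivative_add Ck_on_Suc_has_derivative) auto
    show "Ck_on k (\<lambda>x. frechet_derivative f (at x) v + frechet_derivative g (at x) v) S" for v
      by (rule Suc.IH) (use Suc.prems in simp_all)
  qed
qed

lemma Ck_on_bilinear:
  assumes "bounded_bilinear h" "open S" "Ck_on k f S" "Ck_on k g S"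
  shows "Ck_on k (\<lambda>x. h (f x) (g x)) S"
  using assms(3,4)
proof (induction k arbitrary: f g)
  case 0
  then show ?case using assms(1) by (auto intro: bounded_bilinear.continuous_on)
next
  case (Suc k)
  show ?case
  proof (rule Ck_on_SucI[OF assms(2)])
    show "((\<lambda>x. h (f x) (g x)) has_derivative
        (\<lambda>v. h (f x) (frechet_derivative g (at x) v) + h (frechet_derivative f (at x) v) (g x))) (at x)"
      if "x \<in> S" for x
      using Suc.prems that assms
      by (intro bounded_bilinear.FDERIV Ck_on_Suc_has_derivative) auto
    show "Ck_on k (\<lambda>x. h (f x) (frechet_derivative g (at x) v)
        + h (frechet_derivative f (at x) v) (g x)) S" for v
      by (rule Ck_on_add[OF assms(2)]; rule Suc.IH)
        (use Suc.prems Ck_on_SucD[OF Suc.prems(1)] Ck_on_SucD[OF Suc.prems(2)] in simp_all)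
  qed
qed

lemma Ck_on_sum:
  assumes "open S" "finite I" "\<And>i. i \<in> I \<Longrightarrow> Ck_on k (f i) S"
  shows "Ck_on k (\<lambda>x. \<Sum>i\<in>I. f i x) S"
  using assms(2,3)
proof (induction rule: finite_induct)
  case empty
  then show ?case by (simp add: Ck_on_const)
next
  case (insert i I)
  then show ?case by (simp add: Ck_on_add[OF assms(1)])
qed

text \<open>Directional derivatives of a composite are not themselves composites, because the direction
  moves with the point. Expanding that direction in the standard basis writes them as sums of
  products of directional derivatives of \<open>f\<close> with composites to which the induction hypothesis
  applies.\<close>

lemma Ck_on_compose:
  fixes f :: "'a::real_normed_vector \<Rightarrow> 'b::euclidean_space"
    and g :: "'b \<Rightarrow> 'c::real_normed_vector"
  assumes "open S" "open T" "f ` S \<subseteq> T" "Ck_on k f S" "Ck_on k g T"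
  shows "Ck_on k (\<lambda>x. g (f x)) S"
  using assms(4,5)
proof (induction k arbitrary: g)
  case 0
  then show ?case
    using assms(3) continuous_on_compose2 by (metis Ck_on.simps(1))
next
  case (Suc k)
  have fd: "(f has_derivative frechet_derivative f (at x)) (at x)" if "x \<in> S" for x
    using Ck_on_Suc_has_derivative[OF Suc.prems(1) assms(1) that] .
  have gd: "(g has_derivative frechet_derivative g (at (f x))) (at (f x))" if "x \<in> S" for x
    using Ck_on_Suc_has_derivative[OF Suc.prems(2) assms(2)] assms(3) that by blast
  show ?case
  proof (rule Ck_on_SucI[OF assms(1)])
    fix x assume x: "x \<in> S"
    have "((\<lambda>x. g (f x)) has_derivative (\<lambda>v. frechet_derivative g (at (f x))
        (frechet_derivative f (at x) v))) (at x)"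
      using has_derivative_compose[OF fd[OF x] gd[OF x]] .
    also have "(\<lambda>v. frechet_derivative g (at (f x)) (frechet_derivative f (at x) v)) =
        (\<lambda>v. \<Sum>b\<in>Basis. (frechet_derivative f (at x) v \<bullet> b) *\<^sub>R frechet_derivative g (at (f x)) b)"
    proof
      fix v
      interpret linear "frechet_derivative g (at (f x))"
        using gd[OF x] has_derivative_linear by blast
      show "frechet_derivative g (at (f x)) (frechet_derivative f (at x) v) =
          (\<Sum>b\<in>Basis. (frechet_derivative f (at x) v \<bullet> b) *\<^sub>R frechet_derivative g (at (f x)) b)"
        by (subst euclidean_representation[of "frechet_derivative f (at x) v", symmetric])
          (simp only: sum scale)
    qed
    finally show "((\<lambda>x. g (f x)) has_derivative (\<lambda>v. \<Sum>b\<in>Basis.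
        (frechet_derivative f (at x) v \<bullet> b) *\<^sub>R frechet_derivative g (at (f x)) b)) (at x)" .
  next
    fix v
    have "Ck_on k (\<lambda>x. frechet_derivative g (at (f x)) b) S" for b
      using Suc.IH[OF Ck_on_SucD[OF Suc.prems(1)], of "\<lambda>y. frechet_derivative g (at y) b"] Suc.prems(2)
      by simp
    moreover have "Ck_on k (\<lambda>x. frechet_derivative f (at x) v \<bullet> b) S" for b
      using Suc.prems(1) by (auto intro!: Ck_on_bilinear[OF bounded_bilinear_inner assms(1)] Ck_on_const)
    ultimately show "Ck_on k (\<lambda>x. \<Sum>b\<in>Basis.
        (frechet_derivative f (at x) v \<bullet> b) *\<^sub>R frechet_derivative g (at (f x)) b) S"
      by (intro Ck_on_sum Ck_on_bilinear[OF bounded_bilinear_scaleR] assms(1)) auto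
  qed
qed

lemma smooth_on_has_derivative:
  assumes "smooth_on S f" "open S" "x \<in> S"
  shows "(f has_derivative frechet_derivative f (at x)) (at x)"
  using assms(1) by (intro Ck_on_Suc_has_derivative[OF _ assms(2,3), of 0]) (simp only: smooth_on_def)

lemma smooth_on_derivative: "smooth_on S f \<Longrightarrow> smooth_on S (\<lambda>x. frechet_derivative f (at x) v)"
proof -
  assume f: "smooth_on S f"
  have "Ck_on (Suc k) f S" for k
    using f by (simp only: smooth_on_def)
  then show ?thesis
    by (simp add: smooth_on_def)
qed

lemma smooth_on_compose:
  fixes f :: "'a::real_normed_vector \<Rightarrow> 'b::euclidean_space"
  assumes "open S" "open T" "f ` S \<subseteq> T" "smooth_on S f" "smooth_on T g"
  shows "smooth_on S (\<lambda>x. g (f x))"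
  unfolding smooth_on_def
proof
  show "Ck_on k (\<lambda>x. g (f x)) S" for k
    by (rule Ck_on_compose[OF assms(1-3)]) (use assms(4,5) in \<open>simp_all add: smooth_on_def\<close>)
qed

lemma smooth_on_Pair_const:
  fixes a :: "'a::real_normed_vector"
  assumes "open S"
  shows "smooth_on S (\<lambda>x. (a, x))" "smooth_on S (\<lambda>x. (x, a))"
proof -
  have "Ck_on k (\<lambda>x. (0, x) + (a, 0)) S" "Ck_on k (\<lambda>x. (x, 0) + (0, a)) S" for k
    by (intro Ck_on_affine assms bounded_linear_intros)+
  then show "smooth_on S (\<lambda>x. (a, x))" "smooth_on S (\<lambda>x. (x, a))"
    by (simp_all add: smooth_on_def)
qed

section \<open>Finite combinations of vector fields\<close>

definition vf_sum :: "('g vfield \<Rightarrow> 'g \<Rightarrow> real) \<Rightarrow> 'g vfield set \<Rightarrow> 'g vfield" where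
  "vf_sum h B = (\<lambda>p f. \<Sum>E\<in>B. h E p * E p f)"

lemma vf_sum_empty: "vf_sum h {} = (\<lambda>p f. 0)"
  by (simp add: vf_sum_def)

lemma vf_sum_insert:
  "finite B \<Longrightarrow> E \<notin> B \<Longrightarrow> vf_sum h (insert E B) = vf_lincomb 1 (vf_mult (h E) E) 1 (vf_sum h B)"
  by (simp add: vf_sum_def vf_lincomb_def vf_mult_def)

lemma vf_sum_insert_const:
  "finite B \<Longrightarrow> E \<notin> B \<Longrightarrow>
    vf_sum (\<lambda>E _. a E) (insert E B) = vf_lincomb (a E) E 1 (vf_sum (\<lambda>E _. a E) B)"
  by (simp add: vf_sum_def vf_lincomb_def)

section \<open>Left translations in charts\<close>

text \<open>The group multiplication read in the charts \<open>c\<close> and \<open>d\<close> of the factors and \<open>e\<close> of the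
  product.\<close>

definition chart_mult ::
  "('g::group_add, 'e::euclidean_space) chart \<Rightarrow> ('g, 'e) chart \<Rightarrow> ('g, 'e) chart \<Rightarrow> 'e \<times> 'e \<Rightarrow> 'e" where
  "chart_mult c d e = (\<lambda>(x, y). snd e (chart_inv c x + chart_inv d y))"

definition chart_mult_dom ::
  "('g::group_add, 'e::euclidean_space) chart \<Rightarrow> ('g, 'e) chart \<Rightarrow> ('g, 'e) chart \<Rightarrow> ('e \<times> 'e) set" where
  "chart_mult_dom c d e =
     {(x, y). x \<in> snd c ` fst c \<and> y \<in> snd d ` fst d \<and> chart_inv c x + chart_inv d y \<in> fst e}"

locale lie_group_atlas =
  fixes A :: "('g::{topological_group_add, t2_space, second_countable_topology}, 'e::euclidean_space) chart set"
  assumes lie: "lie_group A"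
begin

lemma ex_chart: "\<exists>c\<in>A. p \<in> fst c"
  using lie unfolding lie_group_def smooth_atlas_def by blast

lemma is_chart: "c \<in> A \<Longrightarrow> is_chart c"
  using lie unfolding lie_group_def smooth_atlas_def by blast

lemma
  assumes "c \<in> A"
  shows open_chart_dom: "open (fst c)"
    and open_chart_range: "open (snd c ` fst c)"
    and chart_inv_left: "p \<in> fst c \<Longrightarrow> chart_inv c (snd c p) = p"
    and chart_inv_continuous: "continuous_on (snd c ` fst c) (chart_inv c)"
  using is_chart[OF assms] unfolding is_chart_def homeomorphism_def by blast+

lemma open_chart_mult_dom:
  assumes "c \<in> A" "d \<in> A" "e \<in> A"
  shows "open (chart_mult_dom c d e)"
proof -
  let ?P = "(snd c ` fst c) \<times> (snd d ` fst d)"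
  have "continuous_on ?P (\<lambda>z. chart_inv c (fst z) + chart_inv d (snd z))"
    by (intro continuous_on_add continuous_on_compose2[OF chart_inv_continuous[OF assms(1)]]
        continuous_on_compose2[OF chart_inv_continuous[OF assms(2)]] continuous_intros) auto
  then have "open (?P \<inter> (\<lambda>z. chart_inv c (fst z) + chart_inv d (snd z)) -` fst e)"
    using assms by (intro continuous_open_preimage open_Times open_chart_range open_chart_dom)
  also have "?P \<inter> (\<lambda>z. chart_inv c (fst z) + chart_inv d (snd z)) -` fst e = chart_mult_dom c d e"
    by (auto simp: chart_mult_dom_def)
  finally show ?thesis .
qed

lemma smooth_chart_mult:
  "c \<in> A \<Longrightarrow> d \<in> A \<Longrightarrow> e \<in> A \<Longrightarrow> smooth_on (chart_mult_dom c d e) (chart_mult c d e)"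
  using lie unfolding lie_group_def chart_mult_def chart_mult_dom_def by blast

lemma chart_mult_dom_iff:
  assumes "c \<in> A" "d \<in> A" "p \<in> fst c" "q \<in> fst d"
  shows "(snd c p, snd d q) \<in> chart_mult_dom c d e \<longleftrightarrow> p + q \<in> fst e"
  using assms by (auto simp: chart_mult_dom_def chart_inv_left)

lemma translate_eq_chart_mult:
  assumes "b \<in> A" "c \<in> A" "e \<in> A" "a \<in> fst b" "(snd b a, z) \<in> chart_mult_dom b c e"
  shows "f (a + chart_inv c z) = (f \<circ> chart_inv e) (chart_mult b c e (snd b a, z))"
  using assms by (auto simp: chart_mult_dom_def chart_mult_def chart_inv_left)

lemma chart_mult_mem:
  assumes "z \<in> chart_mult_dom b c e"
  shows "chart_mult b c e z \<in> snd e ` fst e"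
  using assms by (auto simp: chart_mult_dom_def chart_mult_def)

lemma open_slice:
  assumes "b \<in> A" "c \<in> A" "e \<in> A"
  shows "open {z. (x, z) \<in> chart_mult_dom b c e}"
proof -
  have "open ((\<lambda>z. (x, z)) -` chart_mult_dom b c e)"
    by (intro open_vimage open_chart_mult_dom assms continuous_intros)
  then show ?thesis by (simp add: vimage_def)
qed

text \<open>Near a point of the chart \<open>c\<close>, the translate is \<open>f\<close>, read in a chart at the translated point,
  composed with a slice of the multiplication. That chart depends on the point, hence the
  localisation.\<close>

lemma smooth_fun_translate:
  assumes f: "smooth_fun A f"
  shows "smooth_fun A (\<lambda>q. f (a + q))"
  unfolding smooth_fun_def smooth_on_def
proof (intro ballI allI)
  fix c k assume c: "c \<in> A"
  obtain b where b: "b \<in> A" "a \<in> fst b" using ex_chart by blast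
  show "Ck_on k ((\<lambda>q. f (a + q)) \<circ> chart_inv c) (snd c ` fst c)"
  proof (rule Ck_on_local[OF open_chart_range[OF c]])
    fix z assume z: "z \<in> snd c ` fst c"
    obtain e where e: "e \<in> A" "a + chart_inv c z \<in> fst e" using ex_chart by blast
    let ?T = "{z. (snd b a, z) \<in> chart_mult_dom b c e}"
    have T: "open ?T" using open_slice b c e by blast
    have "smooth_on ?T (\<lambda>z. chart_mult b c e (snd b a, z))"
      using T open_chart_mult_dom[OF b(1) c e(1)] smooth_chart_mult[OF b(1) c e(1)]
      by (intro smooth_on_compose[where T = "chart_mult_dom b c e" and g = "chart_mult b c e"
            and f = "\<lambda>z. (snd b a, z)"] smooth_on_Pair_const) auto
    then have "smooth_on ?T (\<lambda>z. (f \<circ> chart_inv e) (chart_mult b c e (snd b a, z)))"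
      using T open_chart_range[OF e(1)] f e(1) chart_mult_mem[where b = b and c = c and e = e]
      by (intro smooth_on_compose[where T = "snd e ` fst e" and g = "f \<circ> chart_inv e"
            and f = "\<lambda>z. chart_mult b c e (snd b a, z)"]) (auto simp: smooth_fun_def)
    then have "Ck_on k (\<lambda>z. (f \<circ> chart_inv e) (chart_mult b c e (snd b a, z))) ?T"
      by (simp add: smooth_on_def)
    then have "Ck_on k ((\<lambda>q. f (a + q)) \<circ> chart_inv c) ?T"
      using translate_eq_chart_mult[OF b(1) c e(1) b(2), where f = f]
      by (intro Ck_on_cong[OF T _ \<open>Ck_on k _ ?T\<close>]) auto
    moreover have "z \<in> ?T"
      using z b e c by (auto simp: chart_mult_dom_def chart_inv_left)
    moreover have "?T \<subseteq> snd c ` fst c"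
      by (auto simp: chart_mult_dom_def)
    ultimately show "\<exists>T. open T \<and> z \<in> T \<and> T \<subseteq> snd c ` fst c \<and>
        Ck_on k ((\<lambda>q. f (a + q)) \<circ> chart_inv c) T"
      using T by blast
  qed
qed

lemma smooth_fun_translate_iff: "smooth_fun A (\<lambda>q. f (a + q)) \<longleftrightarrow> smooth_fun A f"
  using smooth_fun_translate[of f a] smooth_fun_translate[of "\<lambda>q. f (a + q)" "- a"]
  by (auto simp: add.assoc[symmetric])

lemma smooth_fun_has_derivative:
  assumes "smooth_fun A f" "c \<in> A" "x \<in> snd c ` fst c"
  shows "(f \<circ> chart_inv c has_derivative frechet_derivative (f \<circ> chart_inv c) (at x)) (at x)"
proof (rule smooth_on_has_derivative)
  show "smooth_on (snd c ` fst c) (f \<circ> chart_inv c)"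
    using assms(1,2) by (simp add: smooth_fun_def)
qed (use assms open_chart_range in auto)

text \<open>The chain rule. A tangent vector vanishes by convention on functions that are not smooth, so
  the two sides can only agree on all functions because translation preserves smoothness in both
  directions.\<close>

lemma d_left_coord_tvector:
  assumes b: "b \<in> A" "a \<in> fst b" and c: "c \<in> A" "p \<in> fst c" and e: "e \<in> A" "a + p \<in> fst e"
  shows "d_left a (coord_tvector A c p w) =
    coord_tvector A e (a + p) (frechet_derivative (chart_mult b c e) (at (snd b a, snd c p)) (0, w))"
proof
  fix f
  show "d_left a (coord_tvector A c p w) f = coord_tvector A e (a + p)
      (frechet_derivative (chart_mult b c e) (at (snd b a, snd c p)) (0, w)) f"
  proof (cases "smooth_fun A f")
    case False
    then show ?thesis by (simp add: d_left_def coord_tvector_def smooth_fun_translate_iff)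
  next
    case True
    let ?T = "{z. (snd b a, z) \<in> chart_mult_dom b c e}"
    let ?M = "chart_mult b c e"
    let ?F = "f \<circ> chart_inv e"
    have mem: "(snd b a, snd c p) \<in> chart_mult_dom b c e"
      using assms by (simp add: chart_mult_dom_iff)
    have M: "(?M has_derivative frechet_derivative ?M (at (snd b a, snd c p))) (at (snd b a, snd c p))"
      using smooth_on_has_derivative[OF smooth_chart_mult open_chart_mult_dom mem] b c e by blast
    have i: "((\<lambda>z. (snd b a, z)) has_derivative (\<lambda>w. (0, w))) (at (snd c p))"
      by (auto intro!: derivative_eq_intros)
    have Mp: "?M (snd b a, snd c p) = snd e (a + p)"
      using assms by (simp add: chart_mult_def chart_inv_left)
    have F: "(?F has_derivative frechet_derivative ?F (at (snd e (a + p))))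
        (at (?M (snd b a, snd c p)))"
      unfolding Mp using smooth_fun_has_derivative[OF True] e by blast
    have "((\<lambda>z. ?F (?M (snd b a, z))) has_derivative (\<lambda>w. frechet_derivative ?F (at (snd e (a + p)))
        (frechet_derivative ?M (at (snd b a, snd c p)) (0, w)))) (at (snd c p))"
      using has_derivative_compose[OF has_derivative_compose[OF i M] F] .
    then have "((\<lambda>q. f (a + q)) \<circ> chart_inv c has_derivative
        (\<lambda>w. frechet_derivative ?F (at (snd e (a + p)))
          (frechet_derivative ?M (at (snd b a, snd c p)) (0, w)))) (at (snd c p))"
      by (rule has_derivative_transform_within_open[OF _ open_slice[OF b(1) c(1) e(1)]])
        (use mem translate_eq_chart_mult[OF b(1) c(1) e(1) b(2), where f = f] in auto)
    from fun_cong[OF frechet_derivative_at[OF this], of w] True show ?thesis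
      by (simp add: d_left_def coord_tvector_def smooth_fun_translate_iff)
  qed
qed

section \<open>Tangent vectors and vector fields\<close>

lemma coord_tvector_lincomb:
  assumes "c \<in> A" "p \<in> fst c"
  shows "coord_tvector A c p (a *\<^sub>R u + b *\<^sub>R v) =
    (\<lambda>f. a * coord_tvector A c p u f + b * coord_tvector A c p v f)"
proof
  fix f
  have "linear (frechet_derivative (f \<circ> chart_inv c) (at (snd c p)))" if "smooth_fun A f"
    using smooth_fun_has_derivative[OF that assms(1)] assms(2) has_derivative_linear by blast
  then show "coord_tvector A c p (a *\<^sub>R u + b *\<^sub>R v) f =
      a * coord_tvector A c p u f + b * coord_tvector A c p v f"
    by (simp add: coord_tvector_def linear_add linear_scale)
qed

lemma coord_tvector_const:
  assumes "c \<in> A" "p \<in> fst c"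
  shows "coord_tvector A c p w (\<lambda>_. k) = 0"
proof -
  have "frechet_derivative (\<lambda>_. k) (at (snd c p)) = (\<lambda>_. 0)"
    using frechet_derivative_at[OF has_derivative_const] by metis
  then show ?thesis by (simp add: coord_tvector_def o_def)
qed

lemma coord_tvector_0: "c \<in> A \<Longrightarrow> p \<in> fst c \<Longrightarrow> coord_tvector A c p 0 = (\<lambda>f. 0)"
  using coord_tvector_lincomb[of c p 0 0 0 0] by simp

lemma coord_tvector_sum:
  assumes "c \<in> A" "p \<in> fst c" "finite B"
  shows "coord_tvector A c p (\<Sum>i\<in>B. a i *\<^sub>R w i) = (\<lambda>f. \<Sum>i\<in>B. a i * coord_tvector A c p (w i) f)"
  using assms(3)
proof (induction rule: finite_induct)
  case empty
  then show ?case using assms by (simp add: coord_tvector_0)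
next
  case (insert i B)
  then show ?case
    using coord_tvector_lincomb[OF assms(1,2), of "a i" "w i" 1 "\<Sum>i\<in>B. a i *\<^sub>R w i"] by simp
qed

lemma coord_tvector_tangent: "c \<in> A \<Longrightarrow> p \<in> fst c \<Longrightarrow> coord_tvector A c p w \<in> tangent_space A p"
  unfolding tangent_space_def by blast

lemma d_left_tangent:
  assumes "v \<in> tangent_space A p"
  shows "d_left a v \<in> tangent_space A (a + p)"
proof -
  obtain c w where c: "c \<in> A" "p \<in> fst c" "v = coord_tvector A c p w"
    using assms unfolding tangent_space_def by blast
  obtain b e where "b \<in> A" "a \<in> fst b" "e \<in> A" "a + p \<in> fst e"
    using ex_chart by meson
  then show ?thesis
    using c d_left_coord_tvector coord_tvector_tangent by metis
qed

lemma d_left_0: "d_left 0 v = v"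
  by (simp add: d_left_def)

lemma d_left_add: "d_left (a :: 'g) (d_left b v) = d_left (a + b) v"
  by (simp add: d_left_def add.assoc)

text \<open>A change of chart is the translation by \<open>0\<close>, read in two different charts.\<close>

lemma tangent_in_chart:
  assumes "v \<in> tangent_space A p" "e \<in> A" "p \<in> fst e"
  shows "\<exists>w. v = coord_tvector A e p w"
proof -
  obtain c w where c: "c \<in> A" "p \<in> fst c" "v = coord_tvector A c p w"
    using assms unfolding tangent_space_def by blast
  obtain b where "b \<in> A" "0 \<in> fst b"
    using ex_chart by meson
  then show ?thesis
    using d_left_coord_tvector[of b 0 c p e w] c assms by (auto simp: d_left_0)
qed

lemma vector_field_tangent:
  assumes "vector_field A X"
  shows "X p \<in> tangent_space A p"
proof -
  obtain c where c: "c \<in> A" "p \<in> fst c" using ex_chart by blast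
  then obtain w where "X p = coord_tvector A c p w"
    using assms unfolding vector_field_def by blast
  then show ?thesis using coord_tvector_tangent[OF c] by simp
qed

lemma vector_field_const:
  assumes "vector_field A X"
  shows "X p (\<lambda>_. k) = 0"
proof -
  obtain c where c: "c \<in> A" "p \<in> fst c" using ex_chart by blast
  then obtain w where "X p = coord_tvector A c p w"
    using tangent_in_chart[OF vector_field_tangent[OF assms]] by blast
  then show ?thesis using coord_tvector_const[OF c] by simp
qed

lemma vector_field_lincomb:
  assumes "vector_field A X" "vector_field A Y"
  shows "vector_field A (vf_lincomb a X b Y)"
  unfolding vector_field_def
proof
  fix c assume c: "c \<in> A"
  let ?S = "snd c ` fst c"
  obtain \<xi> \<eta> where \<xi>: "smooth_on ?S \<xi>" "\<And>p. p \<in> fst c \<Longrightarrow> X p = coord_tvector A c p (\<xi> (snd c p))"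
    and \<eta>: "smooth_on ?S \<eta>" "\<And>p. p \<in> fst c \<Longrightarrow> Y p = coord_tvector A c p (\<eta> (snd c p))"
    using assms c unfolding vector_field_def by meson
  have sc: "Ck_on k (\<lambda>x. r *\<^sub>R \<zeta> x) ?S" if "smooth_on ?S \<zeta>" for k r and \<zeta> :: "'e \<Rightarrow> 'e"
    by (rule Ck_on_bilinear[OF bounded_bilinear_scaleR open_chart_range[OF c] Ck_on_const])
      (use that in \<open>simp add: smooth_on_def\<close>)
  have "smooth_on ?S (\<lambda>x. a *\<^sub>R \<xi> x + b *\<^sub>R \<eta> x)"
    unfolding smooth_on_def using Ck_on_add[OF open_chart_range[OF c] sc[OF \<xi>(1)] sc[OF \<eta>(1)]]
    by blast
  moreover have "vf_lincomb a X b Y p = coord_tvector A c p (a *\<^sub>R \<xi> (snd c p) + b *\<^sub>R \<eta> (snd c p))"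
    if "p \<in> fst c" for p
    using that \<xi>(2) \<eta>(2) by (simp add: coord_tvector_lincomb[OF c] vf_lincomb_def)
  ultimately show "\<exists>\<xi>. smooth_on ?S \<xi> \<and> (\<forall>p\<in>fst c. vf_lincomb a X b Y p = coord_tvector A c p (\<xi> (snd c p)))"
    by (intro exI[of _ "\<lambda>x. a *\<^sub>R \<xi> x + b *\<^sub>R \<eta> x"]) blast
qed

lemma vector_field_mult:
  assumes "smooth_fun A h" "vector_field A X"
  shows "vector_field A (vf_mult h X)"
  unfolding vector_field_def
proof
  fix c assume c: "c \<in> A"
  let ?S = "snd c ` fst c"
  obtain \<xi> where \<xi>: "smooth_on ?S \<xi>" "\<And>p. p \<in> fst c \<Longrightarrow> X p = coord_tvector A c p (\<xi> (snd c p))"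
    using assms(2) c unfolding vector_field_def by meson
  have "Ck_on k (\<lambda>x. (h \<circ> chart_inv c) x *\<^sub>R \<xi> x) ?S" for k
    by (rule Ck_on_bilinear[OF bounded_bilinear_scaleR open_chart_range[OF c]])
      (use assms(1) c \<xi>(1) in \<open>auto simp: smooth_on_def smooth_fun_def o_def\<close>)
  then have "smooth_on ?S (\<lambda>x. (h \<circ> chart_inv c) x *\<^sub>R \<xi> x)"
    unfolding smooth_on_def by blast
  moreover have "vf_mult h X p = coord_tvector A c p ((h \<circ> chart_inv c) (snd c p) *\<^sub>R \<xi> (snd c p))"
    if "p \<in> fst c" for p
    using that \<xi>(2) coord_tvector_lincomb[OF c, of p "h p" "\<xi> (snd c p)" 0 0]
    by (simp add: vf_mult_def chart_inv_left[OF c])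
  ultimately show "\<exists>\<xi>. smooth_on ?S \<xi> \<and> (\<forall>p\<in>fst c. vf_mult h X p = coord_tvector A c p (\<xi> (snd c p)))"
    by (intro exI[of _ "\<lambda>x. (h \<circ> chart_inv c) x *\<^sub>R \<xi> x"]) blast
qed

lemma smooth_fun_const: "smooth_fun A (\<lambda>_. k)"
  by (simp add: smooth_fun_def smooth_on_def o_def Ck_on_const)

lemma vector_field_zero: "vector_field A (\<lambda>p f. 0)"
  unfolding vector_field_def
proof
  fix c assume c: "c \<in> A"
  then show "\<exists>\<xi>. smooth_on (snd c ` fst c) \<xi> \<and> (\<forall>p\<in>fst c. (\<lambda>f. 0) = coord_tvector A c p (\<xi> (snd c p)))"
    by (intro exI[of _ "\<lambda>x. 0"]) (simp add: smooth_on_def Ck_on_const coord_tvector_0)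
qed

lemma vector_field_sum:
  assumes "finite B" "\<And>E. E \<in> B \<Longrightarrow> vector_field A E" "\<And>E. E \<in> B \<Longrightarrow> smooth_fun A (h E)"
  shows "vector_field A (vf_sum h B)"
  using assms
proof (induction rule: finite_induct)
  case empty
  show ?case unfolding vf_sum_empty by (rule vector_field_zero)
next
  case (insert E B)
  show ?case
    unfolding vf_sum_insert[OF insert.hyps]
    by (intro vector_field_lincomb vector_field_mult insert.IH insert.prems) auto
qed

section \<open>Left invariant vector fields\<close>

lemma lie_algebra_vector_field: "X \<in> lie_algebra A \<Longrightarrow> vector_field A X"
  by (simp add: lie_algebra_def)

lemma lie_algebra_at:
  assumes "X \<in> lie_algebra A"
  shows "X p = d_left p (X 0)"
proof -
  have "X p = push_left p X p"
    using assms by (simp add: lie_algebra_def)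
  then show ?thesis by (simp add: push_left_def)
qed

text \<open>Evaluation at the identity maps the Lie algebra onto the tangent space. In a chart \<open>c\<close>, the
  coefficients of the left invariant extension of a tangent vector at \<open>0\<close> are partial derivatives,
  in the second variable, of the group multiplication written with \<open>c\<close> for the first factor and
  for the product; this is why they depend smoothly on the point.\<close>

lemma left_invariant_extension:
  assumes "v \<in> tangent_space A 0"
  shows "(\<lambda>p. d_left p v) \<in> lie_algebra A"
proof -
  obtain d where d: "d \<in> A" "0 \<in> fst d" using ex_chart by blast
  obtain w where w: "v = coord_tvector A d 0 w"
    using tangent_in_chart[OF assms d] by blast
  have "vector_field A (\<lambda>p. d_left p v)"
    unfolding vector_field_def
  proof
    fix c assume c: "c \<in> A"
    let ?\<xi> = "\<lambda>x. frechet_derivative (chart_mult c d c) (at (x, snd d 0)) (0, w)"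
    have "(x, snd d 0) \<in> chart_mult_dom c d c" if x: "x \<in> snd c ` fst c" for x
    proof -
      obtain p where "p \<in> fst c" "x = snd c p" using x by blast
      then show ?thesis
        using chart_mult_dom_iff[OF c d(1) _ d(2)] by simp
    qed
    then have "smooth_on (snd c ` fst c) ?\<xi>"
      by (intro smooth_on_compose[where f = "\<lambda>x. (x, snd d 0)" and T = "chart_mult_dom c d c"
            and g = "\<lambda>z. frechet_derivative (chart_mult c d c) (at z) (0, w)"]
          smooth_on_Pair_const smooth_on_derivative smooth_chart_mult open_chart_mult_dom
          open_chart_range c d(1)) auto
    moreover have "d_left p v = coord_tvector A c p (?\<xi> (snd c p))" if "p \<in> fst c" for p
      using d_left_coord_tvector[OF c that d c, of w] that by (simp add: w)
    ultimately show "\<exists>\<xi>. smooth_on (snd c ` fst c) \<xi> \<and>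
        (\<forall>p\<in>fst c. d_left p v = coord_tvector A c p (\<xi> (snd c p)))"
      by (intro exI[of _ ?\<xi>]) blast
  qed
  moreover have "push_left a (\<lambda>p. d_left p v) = (\<lambda>p. d_left p v)" for a
    by (simp add: push_left_def d_left_add flip: add.assoc)
  ultimately show ?thesis by (simp add: lie_algebra_def)
qed

lemma lie_algebra_eqI:
  assumes "X \<in> lie_algebra A" "Y \<in> lie_algebra A" "X 0 = Y 0"
  shows "X = Y"
proof
  show "X p = Y p" for p
    using lie_algebra_at[OF assms(1), of p] lie_algebra_at[OF assms(2), of p] assms(3) by simp
qed

lemma lie_algebra_lincomb:
  assumes "X \<in> lie_algebra A" "Y \<in> lie_algebra A"
  shows "vf_lincomb a X b Y \<in> lie_algebra A"
proof -
  have "push_left r (vf_lincomb a X b Y) = vf_lincomb a (push_left r X) b (push_left r Y)" for r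
    by (simp add: push_left_def vf_lincomb_def d_left_def)
  then show ?thesis
    using assms by (simp add: lie_algebra_def vector_field_lincomb)
qed

lemma lie_algebra_zero: "(\<lambda>p f. 0) \<in> lie_algebra A"
  by (simp add: lie_algebra_def vector_field_zero push_left_def d_left_def)

lemma lie_algebra_sum:
  assumes "finite B" "B \<subseteq> lie_algebra A"
  shows "vf_sum (\<lambda>E _. a E) B \<in> lie_algebra A"
  using assms
proof (induction rule: finite_induct)
  case empty
  show ?case unfolding vf_sum_empty by (rule lie_algebra_zero)
next
  case (insert E B)
  show ?case
    unfolding vf_sum_insert_const[OF insert.hyps]
    by (intro lie_algebra_lincomb insert.IH) (use insert.prems in auto)
qed

lemma linear_vf_sum:
  fixes L :: "'g vfield \<Rightarrow> real"
  assumes "\<And>a b X Y. X \<in> lie_algebra A \<Longrightarrow> Y \<in> lie_algebra A \<Longrightarrow>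
      L (vf_lincomb a X b Y) = a * L X + b * L Y"
    and "finite B" "B \<subseteq> lie_algebra A"
  shows "L (vf_sum (\<lambda>E _. a E) B) = (\<Sum>E\<in>B. a E * L E)"
  using assms(2,3)
proof (induction rule: finite_induct)
  case empty
  have "L (vf_lincomb 0 (\<lambda>p f. 0) 0 (\<lambda>p f. 0)) = 0"
    by (simp add: assms(1) lie_algebra_zero)
  then show ?case by (simp add: vf_lincomb_def vf_sum_empty)
next
  case (insert E B)
  then show ?case by (simp add: vf_sum_insert_const assms(1) lie_algebra_sum)
qed

section \<open>Linear connections\<close>

lemma vf_lincomb_eq_mult:
  "vf_lincomb a X b Y = vf_lincomb 1 (vf_mult (\<lambda>_. a) X) 1 (vf_mult (\<lambda>_. b) Y)"
  by (simp add: vf_lincomb_def vf_mult_def)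

lemma
  assumes "linear_connection A D"
  shows connection_vector_field: "vector_field A X \<Longrightarrow> vector_field A Y \<Longrightarrow> vector_field A (D X Y)"
    and connection_add_left: "vector_field A X \<Longrightarrow> vector_field A X' \<Longrightarrow> vector_field A Y \<Longrightarrow>
        D (vf_lincomb 1 X 1 X') Y = vf_lincomb 1 (D X Y) 1 (D X' Y)"
    and connection_mult_left: "smooth_fun A h \<Longrightarrow> vector_field A X \<Longrightarrow> vector_field A Y \<Longrightarrow>
        D (vf_mult h X) Y = vf_mult h (D X Y)"
    and connection_add_right: "vector_field A X \<Longrightarrow> vector_field A Y \<Longrightarrow> vector_field A Y' \<Longrightarrow>
        D X (vf_lincomb 1 Y 1 Y') = vf_lincomb 1 (D X Y) 1 (D X Y')"
    and connection_mult_right: "smooth_fun A h \<Longrightarrow> vector_field A X \<Longrightarrow> vector_field A Y \<Longrightarrow>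
        D X (vf_mult h Y) = vf_lincomb 1 (vf_mult (\<lambda>p. X p h) Y) 1 (vf_mult h (D X Y))"
  using assms unfolding linear_connection_def by simp_all

lemma connection_lincomb_left:
  assumes "linear_connection A D" "vector_field A X" "vector_field A Y" "vector_field A Z"
  shows "D (vf_lincomb a X b Y) Z = vf_lincomb a (D X Z) b (D Y Z)"
  unfolding vf_lincomb_eq_mult[of a _ b] using assms(2-)
  by (simp add: connection_add_left[OF assms(1)] connection_mult_left[OF assms(1)]
      smooth_fun_const vector_field_mult)

lemma connection_lincomb_right:
  assumes "linear_connection A D" "vector_field A X" "vector_field A Y" "vector_field A Z"
  shows "D Z (vf_lincomb a X b Y) = vf_lincomb a (D Z X) b (D Z Y)"
proof -
  have "D Z (vf_mult (\<lambda>_. r) W) = vf_mult (\<lambda>_. r) (D Z W)" if "vector_field A W" for r W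
    using that assms(4) by (simp add: connection_mult_right[OF assms(1)] smooth_fun_const
        vector_field_const) (simp add: vf_lincomb_def vf_mult_def)
  then show ?thesis
    unfolding vf_lincomb_eq_mult[of a _ b] using assms(2-)
    by (simp add: connection_add_right[OF assms(1)] smooth_fun_const vector_field_mult)
qed

lemma connection_zero:
  assumes "linear_connection A D" "vector_field A X"
  shows "D (\<lambda>p f. 0) X = (\<lambda>p f. 0)" "D X (\<lambda>p f. 0) = (\<lambda>p f. 0)"
  using connection_lincomb_left[OF assms(1) vector_field_zero vector_field_zero assms(2), of 0 0]
    connection_lincomb_right[OF assms(1) vector_field_zero vector_field_zero assms(2), of 0 0]
  by (simp_all add: vf_lincomb_def)

lemma connections_agree_left:
  assumes "linear_connection A D" "linear_connection A D'" "finite B" "vector_field A Y"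
    and "\<And>E. E \<in> B \<Longrightarrow> vector_field A E" "\<And>E. E \<in> B \<Longrightarrow> smooth_fun A (h E)"
    and "\<And>E. E \<in> B \<Longrightarrow> D' E Y = D E Y"
  shows "D' (vf_sum h B) Y = D (vf_sum h B) Y"
  using assms(3,5-7)
proof (induction rule: finite_induct)
  case empty
  show ?case
    using connection_zero(1)[OF assms(1,4)] connection_zero(1)[OF assms(2,4)]
    by (simp add: vf_sum_empty)
next
  case (insert E B)
  then have "vector_field A (vf_sum h B)" "vector_field A (vf_mult (h E) E)"
    by (simp_all add: vector_field_sum vector_field_mult)
  with insert show ?case
    using assms(4) by (simp add: vf_sum_insert assms(1,2) connection_add_left connection_mult_left)
qed

text \<open>The terms of the Leibniz rule that differentiate the coefficients are the same for all
  connections, so agreement passes from the summands to any combination with smooth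
  coefficients.\<close>

lemma connections_agree_right:
  assumes "linear_connection A D" "linear_connection A D'" "finite B" "vector_field A X"
    and "\<And>E. E \<in> B \<Longrightarrow> vector_field A E" "\<And>E. E \<in> B \<Longrightarrow> smooth_fun A (h E)"
    and "\<And>E. E \<in> B \<Longrightarrow> D' X E = D X E"
  shows "D' X (vf_sum h B) = D X (vf_sum h B)"
  using assms(3,5-7)
proof (induction rule: finite_induct)
  case empty
  show ?case
    using connection_zero(2)[OF assms(1,4)] connection_zero(2)[OF assms(2,4)]
    by (simp add: vf_sum_empty)
next
  case (insert E B)
  then have "vector_field A (vf_sum h B)" "vector_field A (vf_mult (h E) E)"
    by (simp_all add: vector_field_sum vector_field_mult)
  with insert show ?case
    using assms(4) by (simp add: vf_sum_insert assms(1,2) connection_add_right connection_mult_right)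
qed

end

section \<open>The Lie algebra as a Euclidean space\<close>

locale left_statistical_structure = lie_group_atlas A
  for A :: "('g::{topological_group_add, t2_space, second_countable_topology}, 'e::euclidean_space) chart set" +
  fixes g :: "'g \<Rightarrow> 'g tvector \<Rightarrow> 'g tvector \<Rightarrow> real"
    and D :: "'g vfield \<Rightarrow> 'g vfield \<Rightarrow> 'g vfield"
  assumes stat: "left_invariant_statistical_structure A g D"
begin

abbreviation LA where "LA \<equiv> lie_algebra A"
abbreviation ip where "ip \<equiv> lie_inner g"

lemma metric: "riemannian_metric A g"
  using stat unfolding left_invariant_statistical_structure_def left_invariant_metric_def by blast

lemma metric_sym:
  "u \<in> tangent_space A p \<Longrightarrow> v \<in> tangent_space A p \<Longrightarrow> g p u v = g p v u"
  using metric unfolding riemannian_metric_def by blast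

lemma metric_lincomb:
  "u \<in> tangent_space A p \<Longrightarrow> v \<in> tangent_space A p \<Longrightarrow> w \<in> tangent_space A p \<Longrightarrow>
    g p (\<lambda>f. a * u f + b * v f) w = a * g p u w + b * g p v w"
  using metric unfolding riemannian_metric_def by blast

lemma metric_pos: "u \<in> tangent_space A p \<Longrightarrow> u \<noteq> (\<lambda>f. 0) \<Longrightarrow> g p u u > 0"
  using metric unfolding riemannian_metric_def by blast

lemma metric_smooth: "vector_field A X \<Longrightarrow> vector_field A Y \<Longrightarrow> smooth_fun A (\<lambda>p. g p (X p) (Y p))"
  using metric unfolding riemannian_metric_def by blast

lemma metric_left:
  "u \<in> tangent_space A p \<Longrightarrow> v \<in> tangent_space A p \<Longrightarrow>
    g (a + p) (d_left a u) (d_left a v) = g p u v"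
  using stat unfolding left_invariant_statistical_structure_def left_invariant_metric_def by blast

lemma LA_tangent: "X \<in> LA \<Longrightarrow> X p \<in> tangent_space A p"
  using lie_algebra_vector_field vector_field_tangent by blast

text \<open>Both fields at \<open>p\<close> are translates by \<open>p\<close> of their values at the identity, and translation
  is an isometry.\<close>

lemma inner_const:
  assumes "X \<in> LA" "Y \<in> LA"
  shows "g p (X p) (Y p) = ip X Y"
  using metric_left[OF LA_tangent[OF assms(1)] LA_tangent[OF assms(2)], of p 0]
    lie_algebra_at[OF assms(1), of p] lie_algebra_at[OF assms(2), of p]
  by (simp add: lie_inner_def)

lemma inner_sym: "X \<in> LA \<Longrightarrow> Y \<in> LA \<Longrightarrow> ip X Y = ip Y X"
  by (simp add: lie_inner_def metric_sym LA_tangent)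

lemma inner_lincomb_left:
  "X \<in> LA \<Longrightarrow> Y \<in> LA \<Longrightarrow> Z \<in> LA \<Longrightarrow> ip (vf_lincomb a X b Y) Z = a * ip X Z + b * ip Y Z"
  by (simp add: lie_inner_def vf_lincomb_def metric_lincomb LA_tangent)

lemma inner_lincomb_right:
  "X \<in> LA \<Longrightarrow> Y \<in> LA \<Longrightarrow> Z \<in> LA \<Longrightarrow> ip Z (vf_lincomb a X b Y) = a * ip Z X + b * ip Z Y"
  by (simp add: inner_sym[of Z] lie_algebra_lincomb inner_lincomb_left)

lemma inner_sum_left:
  assumes "finite B" "B \<subseteq> LA" "Z \<in> LA"
  shows "ip (vf_sum (\<lambda>E _. a E) B) Z = (\<Sum>E\<in>B. a E * ip E Z)"
  by (rule linear_vf_sum[where L = "\<lambda>X. ip X Z"]) (simp_all add: inner_lincomb_left assms)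

lemma inner_pos:
  assumes "X \<in> LA" "X \<noteq> (\<lambda>p f. 0)"
  shows "ip X X > 0"
proof -
  have "X 0 \<noteq> (\<lambda>f. 0)"
    using assms lie_algebra_eqI[OF assms(1) lie_algebra_zero] by auto
  then show ?thesis
    using metric_pos LA_tangent[OF assms(1)] by (simp add: lie_inner_def)
qed

definition orthonormal :: "'g vfield set \<Rightarrow> bool" where
  "orthonormal B \<longleftrightarrow> finite B \<and> B \<subseteq> LA \<and> (\<forall>E\<in>B. \<forall>F\<in>B. ip E F = (if E = F then 1 else 0))"

lemma orthonormal_inner_sum:
  assumes "orthonormal B" "F \<in> B"
  shows "ip (vf_sum (\<lambda>E _. a E) B) F = a F"
proof -
  have "ip (vf_sum (\<lambda>E _. a E) B) F = (\<Sum>E\<in>B. a E * ip E F)"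
    using assms by (intro inner_sum_left) (auto simp: orthonormal_def)
  also have "\<dots> = (\<Sum>E\<in>B. if E = F then a E else 0)"
    using assms by (intro sum.cong) (auto simp: orthonormal_def)
  also have "\<dots> = a F"
    using assms by (simp add: orthonormal_def)
  finally show ?thesis .
qed

text \<open>The coordinates at the identity of orthonormal fields are linearly independent vectors of the
  model space: a vanishing combination of them is a left invariant field that vanishes at \<open>0\<close>, hence
  everywhere, and its coefficients are inner products with that field.\<close>

lemma orthonormal_card:
  assumes "orthonormal B"
  shows "card B \<le> DIM('e)"
proof -
  have fin: "finite B" and sub: "B \<subseteq> LA"
    using assms by (auto simp: orthonormal_def)
  obtain c where c: "c \<in> A" "0 \<in> fst c" using ex_chart by blast
  have "\<forall>E\<in>B. \<exists>w. E 0 = coord_tvector A c 0 w"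
    using tangent_in_chart[OF LA_tangent c] sub by blast
  then obtain w where w: "\<And>E. E \<in> B \<Longrightarrow> E 0 = coord_tvector A c 0 (w E)"
    by metis
  have inj: "inj_on w B"
    using w sub by (intro inj_onI) (metis lie_algebra_eqI subsetD)
  have "independent (w ` B)"
  proof (rule independent_if_scalars_zero)
    fix r x assume 0: "(\<Sum>x\<in>w ` B. r x *\<^sub>R x) = 0" and x: "x \<in> w ` B"
    then obtain F where F: "F \<in> B" "x = w F" by blast
    have "(\<Sum>E\<in>B. r (w E) *\<^sub>R w E) = 0"
      using 0 by (simp add: sum.reindex[OF inj])
    then have "(\<lambda>f. \<Sum>E\<in>B. r (w E) * coord_tvector A c 0 (w E) f) = (\<lambda>f. 0)"
      using coord_tvector_sum[OF c fin, of "\<lambda>E. r (w E)" w] coord_tvector_0[OF c] by simp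
    then have "vf_sum (\<lambda>E _. r (w E)) B 0 = (\<lambda>f. 0)"
      using w by (simp add: vf_sum_def)
    then have "vf_sum (\<lambda>E _. r (w E)) B = (\<lambda>p f. 0)"
      by (intro lie_algebra_eqI lie_algebra_sum fin sub lie_algebra_zero)
    then have "r (w F) = ip (\<lambda>p f. 0) F"
      using orthonormal_inner_sum[OF assms F(1), of "\<lambda>E. r (w E)"] by simp
    also have "\<dots> = 0"
      using inner_lincomb_left[OF lie_algebra_zero lie_algebra_zero, of F 0 0] F(1) sub
      by (auto simp: vf_lincomb_def)
    finally show "r x = 0" by (simp add: F)
  qed (use fin in simp)
  then show ?thesis
    using independent_bound card_image[OF inj] by metis
qed

text \<open>By the bound on cardinalities there is a largest orthonormal set. It spans, since otherwise
  the normalised residual of a field outside the span could be added to it.\<close>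

lemma ex_orthonormal_basis:
  "\<exists>B. orthonormal B \<and> (\<forall>X\<in>LA. X = vf_sum (\<lambda>E _. ip X E) B)"
proof -
  have "orthonormal {}" by (simp add: orthonormal_def)
  then obtain B where B: "orthonormal B" and max: "\<And>C. orthonormal C \<Longrightarrow> card C \<le> card B"
    using ex_has_greatest_nat[of orthonormal "{}" card "Suc DIM('e)"] orthonormal_card
    by (metis le_imp_less_Suc)
  have fin: "finite B" and sub: "B \<subseteq> LA"
    using B by (auto simp: orthonormal_def)
  have "X = vf_sum (\<lambda>E _. ip X E) B" if X: "X \<in> LA" for X
  proof (rule ccontr)
    assume neq: "X \<noteq> vf_sum (\<lambda>E _. ip X E) B"
    define S where "S = vf_sum (\<lambda>E _. ip X E) B"
    define R where "R = vf_lincomb 1 X (- 1) S"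
    have S: "S \<in> LA" by (simp add: S_def lie_algebra_sum fin sub)
    have R: "R \<in> LA" by (simp add: R_def X S lie_algebra_lincomb)
    have orth: "ip R F = 0" if "F \<in> B" for F
      using that sub orthonormal_inner_sum[OF B that, of "ip X"] inner_lincomb_left[OF X S, of F]
      by (auto simp: R_def S_def)
    have "R \<noteq> (\<lambda>p f. 0)"
      using neq by (auto simp: R_def S_def vf_lincomb_def fun_eq_iff)
    then have pos: "ip R R > 0" using inner_pos R by blast
    define N where "N = vf_lincomb (1 / sqrt (ip R R)) R 0 R"
    have N: "N \<in> LA" by (simp add: N_def R lie_algebra_lincomb)
    have NZ: "ip N Z = ip R Z / sqrt (ip R R)" if "Z \<in> LA" for Z
      using inner_lincomb_left[OF R R that] by (simp add: N_def)
    have NB: "ip N F = 0" if "F \<in> B" for F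
      using that sub NZ orth by auto
    have "ip N N = ip R R / (sqrt (ip R R) * sqrt (ip R R))"
      using NZ[OF N] NZ[OF R] inner_sym[OF R N] by simp
    then have NN: "ip N N = 1" using pos by simp
    have "N \<notin> B" using NB NN by fastforce
    moreover have "orthonormal (insert N B)"
      unfolding orthonormal_def
    proof (intro conjI ballI)
      fix E F assume "E \<in> insert N B" "F \<in> insert N B"
      moreover have "ip F N = 0" if "F \<in> B" for F
        using inner_sym[OF N] NB[OF that] that sub by (metis subsetD)
      moreover have "ip E F = (if E = F then 1 else 0)" if "E \<in> B" "F \<in> B"
        using that B by (simp add: orthonormal_def)
      ultimately show "ip E F = (if E = F then 1 else 0)"
        using NB NN \<open>N \<notin> B\<close> by (metis insertE)
    qed (use fin sub N in auto)
    ultimately show False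
      using max[of "insert N B"] fin by simp
  qed
  with B show ?thesis by blast
qed

text \<open>The representing element has the values of the functional on an orthonormal basis as
  coefficients.\<close>

lemma inner_representation:
  assumes L: "\<And>a b X Y. X \<in> LA \<Longrightarrow> Y \<in> LA \<Longrightarrow> L (vf_lincomb a X b Y) = a * L X + b * L Y"
  shows "\<exists>!W. W \<in> LA \<and> (\<forall>Z\<in>LA. ip W Z = L Z)"
proof -
  obtain B where B: "orthonormal B" and ex: "\<And>X. X \<in> LA \<Longrightarrow> X = vf_sum (\<lambda>E _. ip X E) B"
    using ex_orthonormal_basis by blast
  have fin: "finite B" and sub: "B \<subseteq> LA"
    using B by (auto simp: orthonormal_def)
  let ?W = "vf_sum (\<lambda>E _. L E) B"
  have W: "?W \<in> LA" by (simp add: lie_algebra_sum fin sub)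
  have rep: "ip ?W Z = L Z" if Z: "Z \<in> LA" for Z
  proof -
    have "ip ?W Z = (\<Sum>E\<in>B. L E * ip E Z)"
      by (rule inner_sum_left[OF fin sub Z])
    also have "\<dots> = (\<Sum>E\<in>B. ip Z E * L E)"
      using sub Z by (intro sum.cong) (auto simp: inner_sym)
    also have "\<dots> = L (vf_sum (\<lambda>E _. ip Z E) B)"
      by (rule linear_vf_sum[symmetric]) (simp_all add: L fin sub)
    finally show ?thesis using ex[OF Z] by simp
  qed
  have "V = ?W" if "V \<in> LA" "\<forall>Z\<in>LA. ip V Z = L Z" for V
  proof -
    have "V = vf_sum (\<lambda>E _. ip V E) B" by (rule ex[OF that(1)])
    also have "\<dots> = ?W"
      using that(2) sub by (auto simp: vf_sum_def fun_eq_iff intro!: sum.cong)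
    finally show ?thesis .
  qed
  with W rep show ?thesis by blast
qed

text \<open>An orthonormal basis of the Lie algebra is an orthonormal frame at every point, so the
  coefficients of a vector field in it are its inner products with the frame. These are smooth
  because the metric is.\<close>

lemma ex_global_frame:
  "\<exists>B. finite B \<and> B \<subseteq> LA \<and>
    (\<forall>X. vector_field A X \<longrightarrow> X = vf_sum (\<lambda>E p. g p (X p) (E p)) B)"
proof -
  obtain B where B: "orthonormal B" and ex: "\<And>X. X \<in> LA \<Longrightarrow> X = vf_sum (\<lambda>E _. ip X E) B"
    using ex_orthonormal_basis by blast
  have fin: "finite B" and sub: "B \<subseteq> LA"
    using B by (auto simp: orthonormal_def)
  have "X p = vf_sum (\<lambda>E p. g p (X p) (E p)) B p" if X: "vector_field A X" for X p
  proof -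
    \<comment> \<open>the left invariant field that agrees with \<open>X\<close> at \<open>p\<close>\<close>
    define V where "V = (\<lambda>q. d_left q (d_left (- p) (X p)))"
    have "d_left (- p) (X p) \<in> tangent_space A (- p + p)"
      by (intro d_left_tangent vector_field_tangent X)
    then have V: "V \<in> LA"
      unfolding V_def by (intro left_invariant_extension) simp
    have Vp: "V p = X p" by (simp add: V_def d_left_add d_left_0)
    have "X p = vf_sum (\<lambda>E _. ip V E) B p"
      using ex[OF V] Vp by metis
    also have "\<dots> = vf_sum (\<lambda>E p. g p (X p) (E p)) B p"
      using sub inner_const[OF V, of _ p] by (auto simp: vf_sum_def Vp intro!: sum.cong ext)
    finally show ?thesis .
  qed
  with fin sub show ?thesis by blast
qed

section \<open>Statistical connections\<close>

lemma
  shows left_connection: "left_invariant_connection A D"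
    and torsion_free: "torsion_free A D"
    and cubic_form_symmetric: "totally_symmetric A (nabla_metric g D)"
  using stat by (simp_all only: left_invariant_statistical_structure_def)

lemma connection: "linear_connection A D"
  using left_connection by (simp only: left_invariant_connection_def)

lemma connection_LA:
  assumes "X \<in> LA" "Y \<in> LA"
  shows "D X Y \<in> LA"
proof -
  have "D (push_left a X) (push_left a Y) = push_left a (D X Y)" for a
    using left_connection assms by (simp add: left_invariant_connection_def lie_algebra_vector_field)
  then have "push_left a (D X Y) = D X Y" for a
    using assms by (simp add: lie_algebra_def)
  then show ?thesis
    using connection_vector_field[OF connection] assms by (simp add: lie_algebra_def)
qed

text \<open>In this form of the torsion condition, closure of the Lie algebra under the bracket and
  bilinearity of the bracket are inherited from the connection.\<close>

lemma bracket_eq: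
  assumes "X \<in> LA" "Y \<in> LA"
  shows "lie_bracket X Y = vf_lincomb 1 (D X Y) (- 1) (D Y X)"
  using torsion_free assms by (simp add: torsion_free_def lie_algebra_vector_field)

lemma inner_bracket:
  assumes "X \<in> LA" "Y \<in> LA" "Z \<in> LA"
  shows "ip Z (lie_bracket X Y) = ip (D X Y) Z - ip (D Y X) Z"
  using assms by (simp add: bracket_eq inner_lincomb_right connection_LA inner_sym[of Z])

text \<open>The derivative term of the covariant derivative of the metric vanishes on left invariant
  fields, whose inner products are constant.\<close>

lemma codazzi:
  assumes "X \<in> LA" "Y \<in> LA" "Z \<in> LA"
  shows "ip (D X Y) Z + ip (D X Z) Y = ip (D Y X) Z + ip (D Y Z) X"
proof -
  have n: "nabla_metric g D P Q R 0 = - ip (D P Q) R - ip (D P R) Q"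
    if "P \<in> LA" "Q \<in> LA" "R \<in> LA" for P Q R
  proof -
    have "P 0 (\<lambda>q. g q (Q q) (R q)) = 0"
      using that by (simp add: inner_const vector_field_const lie_algebra_vector_field)
    then show ?thesis
      using inner_sym[OF that(2) connection_LA[OF that(1,3)]]
      by (simp add: nabla_metric_def lie_inner_def)
  qed
  have "nabla_metric g D X Y Z = nabla_metric g D Y X Z"
    using cubic_form_symmetric assms lie_algebra_vector_field
    unfolding totally_symmetric_def by blast
  then show ?thesis
    using n[OF assms] n[OF assms(2,1,3)] by simp
qed

lemma U_map_inner:
  assumes "X \<in> LA" "Y \<in> LA" "Z \<in> LA"
  shows "2 * ip (U_map A g X Y) Z = ip X (lie_bracket Z Y) + ip Y (lie_bracket Z X)"
proof -
  let ?L = "\<lambda>Z. (ip X (lie_bracket Z Y) + ip Y (lie_bracket Z X)) / 2"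
  have lin: "?L (vf_lincomb a P b Q) = a * ?L P + b * ?L Q" if "P \<in> LA" "Q \<in> LA" for a b P Q
    using that assms
    by (simp add: inner_bracket lie_algebra_lincomb lie_algebra_vector_field connection_LA
        connection_lincomb_left[OF connection] connection_lincomb_right[OF connection]
        inner_lincomb_left) (simp add: algebra_simps)
  have "\<exists>!W. W \<in> LA \<and> (\<forall>Z\<in>LA. 2 * ip W Z = ip X (lie_bracket Z Y) + ip Y (lie_bracket Z X))"
    using inner_representation[of ?L, OF lin] by (simp add: eq_divide_eq mult.commute)
  from theI'[OF this] assms(3) show ?thesis
    unfolding U_map_def by blast
qed

definition sym_part :: "'g vfield \<Rightarrow> 'g vfield \<Rightarrow> 'g vfield" where
  "sym_part X Y = vf_lincomb (1 / 2) (D X Y) (1 / 2) (D Y X)"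

lemma sym_part_bilinear: "symmetric_bilinear_on_lie_algebra A sym_part"
proof -
  have "sym_part X Y \<in> LA \<and> sym_part X Y = sym_part Y X" if "X \<in> LA" "Y \<in> LA" for X Y
  proof
    show "sym_part X Y \<in> LA"
      unfolding sym_part_def by (intro lie_algebra_lincomb connection_LA that)
    show "sym_part X Y = sym_part Y X"
      by (simp add: sym_part_def vf_lincomb_def add.commute)
  qed
  moreover have "sym_part (vf_lincomb a X b Y) Z = vf_lincomb a (sym_part X Z) b (sym_part Y Z) \<and>
      sym_part Z (vf_lincomb a X b Y) = vf_lincomb a (sym_part Z X) b (sym_part Z Y)"
    if "X \<in> LA" "Y \<in> LA" "Z \<in> LA" for X Y Z a b
    using that
    by (simp add: sym_part_def lie_algebra_vector_field
        connection_lincomb_left[OF connection] connection_lincomb_right[OF connection])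
      (simp add: vf_lincomb_def algebra_simps)
  ultimately show ?thesis
    unfolding symmetric_bilinear_on_lie_algebra_def by blast
qed

lemma sym_part_represents: "represented_by A D sym_part"
  unfolding represented_by_def
proof (intro ballI)
  fix X Y assume "X \<in> LA" "Y \<in> LA"
  then have "lie_bracket X Y = vf_lincomb 1 (D X Y) (- 1) (D Y X)"
    by (rule bracket_eq)
  then show "D X Y = vf_lincomb 1 (sym_part X Y) (1 / 2) (lie_bracket X Y)"
    by (simp add: sym_part_def vf_lincomb_def algebra_simps)
qed

text \<open>Written in inner products of covariant derivatives, the two sides have the same terms in
  \<open>\<nabla>\<^sub>Z X\<close> and \<open>\<nabla>\<^sub>Z Y\<close>; the equality of the other terms is the identity \<open>codazzi\<close>.\<close>

lemma sym_part_U_map: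
  assumes "X \<in> LA" "Y \<in> LA" "Z \<in> LA"
  shows "ip (U_map A g Y Z) X - ip (U_map A g X Z) Y = ip (sym_part Y Z) X - ip (sym_part X Z) Y"
proof -
  have "2 * ip (U_map A g Y Z) X =
      ip (D X Z) Y - ip (D Z X) Y + (ip (D X Y) Z - ip (D Y X) Z)"
    "2 * ip (U_map A g X Z) Y =
      ip (D Y Z) X - ip (D Z Y) X + (ip (D Y X) Z - ip (D X Y) Z)"
    using assms by (simp_all add: U_map_inner inner_bracket)
  moreover have "2 * ip (sym_part Y Z) X = ip (D Y Z) X + ip (D Z Y) X"
    "2 * ip (sym_part X Z) Y = ip (D X Z) Y + ip (D Z X) Y"
    using assms by (simp_all add: sym_part_def inner_lincomb_left connection_LA)
  ultimately show ?thesis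
    using codazzi[OF assms] by argo
qed

lemma connection_determined_on_LA:
  assumes D': "linear_connection A D'"
    and agree: "\<And>X Y. X \<in> LA \<Longrightarrow> Y \<in> LA \<Longrightarrow> D' X Y = D X Y"
    and X: "vector_field A X" and Y: "vector_field A Y"
  shows "D' X Y = D X Y"
proof -
  obtain B where B: "finite B" "B \<subseteq> LA"
    and ex: "\<And>X. vector_field A X \<Longrightarrow> X = vf_sum (\<lambda>E p. g p (X p) (E p)) B"
    using ex_global_frame by blast
  have vf: "vector_field A E" if "E \<in> B" for E
    using that B lie_algebra_vector_field by blast
  define h where "h = (\<lambda>(X :: 'g vfield) (E :: 'g vfield) p. g p (X p) (E p))"
  have h: "smooth_fun A (h Z E)" if "vector_field A Z" "E \<in> B" for Z E
    unfolding h_def by (rule metric_smooth[OF that(1) vf[OF that(2)]])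
  have sum: "vf_sum (h Z) B = Z" if "vector_field A Z" for Z
    unfolding h_def using ex[OF that] by (rule sym)
  have "D' E (vf_sum (h Y) B) = D E (vf_sum (h Y) B)" if E: "E \<in> B" for E
    using connection D' B(1) vf[OF E] vf h[OF Y]
  proof (rule connections_agree_right)
    show "D' E F = D E F" if "F \<in> B" for F
      using E that B(2) agree by blast
  qed
  then have on_B: "D' E Y = D E Y" if "E \<in> B" for E
    using that by (simp only: sum[OF Y])
  have "D' (vf_sum (h X) B) Y = D (vf_sum (h X) B) Y"
    by (rule connections_agree_left[OF connection D' B(1) Y]) (fact vf, fact h[OF X], fact on_B)
  then show ?thesis
    by (simp only: sum[OF X])
qed

end

theorem proposition5p1:
  fixes A :: "('g::{topological_group_add, t2_space, second_countable_topology}, 'e::euclidean_space) chart set"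
    and g :: "'g \<Rightarrow> 'g tvector \<Rightarrow> 'g tvector \<Rightarrow> real"
    and D :: "'g vfield \<Rightarrow> 'g vfield \<Rightarrow> 'g vfield"
  assumes "lie_group A"
    and "left_invariant_statistical_structure A g D"
  shows "\<exists>\<nu>. symmetric_bilinear_on_lie_algebra A \<nu> \<and>
    (\<forall>X\<in>lie_algebra A. \<forall>Y\<in>lie_algebra A. \<forall>Z\<in>lie_algebra A.
       lie_inner g (U_map A g Y Z) X - lie_inner g (U_map A g X Z) Y
         = lie_inner g (\<nu> Y Z) X - lie_inner g (\<nu> X Z) Y) \<and>
    represented_by A D \<nu> \<and>
    (\<forall>D'. left_invariant_connection A D' \<longrightarrow> represented_by A D' \<nu> \<longrightarrow>
       (\<forall>X Y. vector_field A X \<longrightarrow> vector_field A Y \<longrightarrow> D' X Y = D X Y))"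
proof -
  interpret left_statistical_structure A g D
    using assms by unfold_locales
  have "D' X Y = D X Y" if D': "left_invariant_connection A D'" "represented_by A D' sym_part"
    and X: "vector_field A X" and Y: "vector_field A Y" for D' X Y
  proof (rule connection_determined_on_LA[OF _ _ X Y])
    show "linear_connection A D'"
      using D'(1) by (simp only: left_invariant_connection_def)
    show "D' V W = D V W" if "V \<in> lie_algebra A" "W \<in> lie_algebra A" for V W
      using that D'(2) sym_part_represents by (simp add: represented_by_def)
  qed
  then show ?thesis
    using sym_part_bilinear sym_part_represents sym_part_U_map
    by (intro exI[of _ sym_part] conjI ballI allI impI) simp_all
qed

end
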